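(* Let $f:\mathbb{T}\to\mathbb{R}$ be a continuous even function with mean value $0$ satisfying $$\widehat f(k)>0\ \text{ for all } k\in\mathbb{Z}\setminus\{0\}\qquad\text{and}\qquad\sum_{k\in\mathbb{Z}}\widehat f(k)<\infty.$$ Let $\{x_1,\dots,x_m\}\subset\mathbb{T}$ be an arbitrary finite initial set ($m\ge1$) and let $(x_n)_{n\ge1}$ be any sequence in $\mathbb{T}$ extending it such that for every $n>m$ $$x_n\in\arg\min_{x\in\mathbb{T}}\sum_{k=1}^{n-1}f(x-x_k).$$ Then there is a constant $C>0$, depending only on $f$ and the initial set, such that for all $n\ge1$ $$\left\|\sum_{k=1}^n f(x-x_k)\right\|_{L^\infty}\le C\sqrt n.$$
   Context: $\mathbb{T}=\mathbb{R}/\mathbb{Z}\cong[0,1)$ is the one-dimensional torus with Lebesgue (Haar) probability measure $dx$; $\widehat f(k)=\int_{\mathbb{T}}f(x)e^{-2\pi i kx}\,dx$. The $L^\infty$ norm is over $x\in\mathbb{T}$. If the minimum is attained at several points, any of them may be chosen. *)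

theory Defs
  imports "HOL-Probability.Essential_Supremum" "HOL-Library.Complex_Order"
begin

text \<open>
  The torus \<open>\<real>/\<int>\<close> is represented by its fundamental domain \<open>[0,1)\<close>; functions on
  it are \<open>1\<close>-periodic functions on the reals, so that continuity on the reals is continuity
  on the torus, and differences of points need no reduction modulo \<open>1\<close>.
\<close>

definition torus :: "real measure" where
  "torus = restrict_space lborel {0..<1}"

definition fourier_coeff :: "(real \<Rightarrow> real) \<Rightarrow> int \<Rightarrow> complex" where
  "fourier_coeff f k =
    (LINT x|torus. complex_of_real (f x)
       * exp (- 2 * complex_of_real pi * \<i> * of_int k * complex_of_real x))"

definition Linf_norm :: "(real \<Rightarrow> real) \<Rightarrow> ereal" where
  "Linf_norm g = esssup torus (\<lambda>x. ereal \<bar>g x\<bar>)"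

end

theory Submission
  imports Defs
begin

text \<open>
  Write \<open>F\<^sub>n(y) = (\<Sum>k\<le>n. f(y - x\<^sub>k))\<close> for the potential of the first \<open>n\<close> points and
  \<open>E\<^sub>n = (\<Sum>k,l\<le>n. f(x\<^sub>k - x\<^sub>l))\<close> for their energy. Two facts about the energy combine.

  Greedy points have small energy. Since \<open>f\<close> has mean zero, so has every \<open>F\<^sub>n\<close>, hence its minimum
  is at most \<open>0\<close>. As \<open>f\<close> is even, a point placed at that minimum gives
  \<open>E\<^bsub>n+1\<^esub> = E\<^sub>n + 2 min F\<^sub>n + f(0) \<le> E\<^sub>n + f(0)\<close>. So the energy grows at most linearly,
  with constants that see only \<open>f\<close> and the number of initial points (\<open>energy_le\<close>).

  Small energy forces a small potential. Put \<open>S\<^sub>j = (\<Sum>k\<le>n. e(j x\<^sub>k))\<close> with \<open>e(t)\<close> the exponential of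
  \<open>2 \<pi> i t\<close>, and let \<open>a\<^sub>j \<ge> 0\<close> be the Fourier coefficients of \<open>f\<close>. The Fourier expansion of \<open>f\<close>
  gives \<open>E\<^sub>n = (\<Sum>j. a\<^sub>j |S\<^sub>j|\<^sup>2)\<close> and \<open>|F\<^sub>n(y)| \<le> (\<Sum>j. a\<^sub>j |S\<^sub>j|)\<close>, while \<open>(\<Sum>j. a\<^sub>j) = f(0)\<close>. The
  Cauchy-Schwarz inequality bounds \<open>F\<^sub>n\<^sup>2\<close> by \<open>f(0) E\<^sub>n\<close>, which is of order \<open>n\<close>. It is used in the
  form \<open>|S\<^sub>j| \<le> (t + |S\<^sub>j|\<^sup>2 / t) / 2\<close> with \<open>t = sqrt n\<close> (\<open>abs_potential_le\<close>).

  The analytic input is that \<open>f\<close> equals its absolutely convergent Fourier series everywhere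
  (\<open>fourier_inversion\<close>). The series converges uniformly to a continuous function with the same
  coefficients, and a continuous periodic function all of whose coefficients vanish is zero, by
  the Stone-Weierstrass theorem on the unit circle (\<open>orthogonal_to_characters_imp_eq_0\<close>).
\<close>

section \<open>Characters of the torus\<close>

definition character :: "int \<Rightarrow> real \<Rightarrow> complex" where
  "character k x = cis (2 * pi * of_int k * x)"

lemma norm_character [simp]: "norm (character k x) = 1"
  by (simp add: character_def)

lemma character_0 [simp]: "character 0 x = 1" "character k 0 = 1"
  by (simp_all add: character_def)

lemma character_add: "character (j + k) x = character j x * character k x"
  by (simp add: character_def cis_mult algebra_simps)

lemma character_diff_right: "character k (x - y) = character k x * cnj (character k y)"
  by (simp add: character_def cis_mult cis_cnj algebra_simps)

lemma character_periodic [simp]: "character k (x + 1) = character k x"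
proof -
  have "character k (x + 1) = character k x * cis (2 * pi * of_int k)"
    by (simp add: character_def cis_mult algebra_simps)
  also have "cis (2 * pi * of_int k) = 1"
    by (simp add: cis_multiple_2pi)
  finally show ?thesis by simp
qed

lemma continuous_on_character [continuous_intros]:
  "continuous_on S g \<Longrightarrow> continuous_on S (\<lambda>x. character k (g x))"
  unfolding character_def by (intro continuous_intros)

lemma has_integral_character:
  "(character k has_integral (if k = 0 then 1 else 0)) {0..1}"
proof (cases "k = 0")
  case True
  moreover have "character 0 = (\<lambda>x. 1)" by (simp add: fun_eq_iff)
  ultimately show ?thesis
    using has_integral_const_real[of "1::complex" 0 1] by simp
next
  case False
  define c where "c = 2 * pi * of_int k"
  have c: "c \<noteq> 0" using False by (simp add: c_def)
  have "((\<lambda>x. cis (c * x)) has_integral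
      (- \<i> / of_real c * cis (c * 1) - (- \<i> / of_real c * cis (c * 0)))) {0..1}"
  proof (rule fundamental_theorem_of_calculus)
    fix x :: real
    have "((\<lambda>z. - \<i> / of_real c * exp (\<i> * of_real c * z)) has_field_derivative
        exp (\<i> * of_real c * of_real x)) (at (of_real x))"
      using c by (auto intro!: derivative_eq_intros simp: field_simps)
    from has_vector_derivative_at_within[OF has_vector_derivative_real_field[OF this]]
    show "((\<lambda>x. - \<i> / of_real c * cis (c * x)) has_vector_derivative cis (c * x)) (at x within {0..1})"
      by (simp add: cis_conv_exp mult_ac)
  qed simp
  moreover have "cis c = 1"
    by (simp add: c_def cis_multiple_2pi)
  ultimately show ?thesis
    using False by (simp add: character_def [abs_def] c_def)
qed

text \<open>
  By the Weierstrass M-test the partial sums converge uniformly, so the limit is continuous and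
  may be integrated term by term; orthogonality of the characters leaves the \<open>k\<close>-th term only.
\<close>

lemma fourier_series:
  assumes b: "(\<lambda>k. norm (b k)) summable_on UNIV"
  shows continuous_on_fourier_series: "continuous_on UNIV (\<lambda>x. \<Sum>\<^sub>\<infinity>j. b j * character j x)"
    and has_integral_fourier_series:
      "((\<lambda>x. (\<Sum>\<^sub>\<infinity>j. b j * character j x) * character (- k) x) has_integral b k) {0..1}"
proof -
  have ul: "uniform_limit UNIV (\<lambda>F x. \<Sum>j\<in>F. b j * character j x)
      (\<lambda>x. \<Sum>\<^sub>\<infinity>j. b j * character j x) (finite_subsets_at_top UNIV)"
    by (rule Weierstrass_m_test_general[OF _ b]) (simp add: norm_mult)
  show "continuous_on UNIV (\<lambda>x. \<Sum>\<^sub>\<infinity>j. b j * character j x)"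
    by (rule uniform_limit_theorem[OF _ ul])
       (auto intro!: always_eventually continuous_intros)
  have "uniform_limit UNIV (\<lambda>F x. \<Sum>j\<in>F. b j * character (j - k) x)
      (\<lambda>x. \<Sum>\<^sub>\<infinity>j. b j * character (j - k) x) (finite_subsets_at_top UNIV)"
    by (rule Weierstrass_m_test_general[OF _ b]) (simp add: norm_mult)
  also have "(\<lambda>x. \<Sum>\<^sub>\<infinity>j. b j * character (j - k) x) =
      (\<lambda>x. (\<Sum>\<^sub>\<infinity>j. b j * character j x) * character (- k) x)"
    by (simp add: infsum_cmult_left' [symmetric] mult.assoc flip: character_add)
  finally have "uniform_limit (cbox 0 1) (\<lambda>F x. \<Sum>j\<in>F. b j * character (j - k) x)
      (\<lambda>x. (\<Sum>\<^sub>\<infinity>j. b j * character j x) * character (- k) x) (finite_subsets_at_top UNIV)"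
    by (rule uniform_limit_on_subset) simp
  then obtain I J where I: "\<And>F. ((\<lambda>x. \<Sum>j\<in>F. b j * character (j - k) x) has_integral I F) (cbox 0 1)"
    and J: "((\<lambda>x. (\<Sum>\<^sub>\<infinity>j. b j * character j x) * character (- k) x) has_integral J) (cbox 0 1)"
    and lim: "(I \<longlongrightarrow> J) (finite_subsets_at_top UNIV)"
    by (rule uniform_limit_integral_cbox) (auto intro!: continuous_intros)
  \<comment> \<open>the integrals of the partial sums are constant as soon as the index set contains \<open>k\<close>\<close>
  have "I F = b k" if F: "finite F" "k \<in> F" for F
  proof -
    have "((\<lambda>x. \<Sum>j\<in>F. b j * character (j - k) x) has_integral
        (\<Sum>j\<in>F. b j * (if j - k = 0 then 1 else 0))) {0..1}"
      by (intro has_integral_sum has_integral_mult_right has_integral_character F)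
    then have "I F = (\<Sum>j\<in>F. b j * (if j - k = 0 then 1 else 0))"
      by (intro has_integral_unique[OF I]) simp
    also have "(\<Sum>j\<in>F. b j * (if j - k = 0 then 1 else 0)) = b k"
      using F by (subst sum.remove[of _ k]) (auto intro!: sum.neutral)
    finally show ?thesis .
  qed
  then have "\<forall>\<^sub>F F in finite_subsets_at_top UNIV. I F = b k"
    unfolding eventually_finite_subsets_at_top by (intro exI[of _ "{k}"]) auto
  then have "J = b k"
    using tendsto_unique[OF finite_subsets_at_top_neq_bot lim] by (simp add: tendsto_eventually)
  with J show "((\<lambda>x. (\<Sum>\<^sub>\<infinity>j. b j * character j x) * character (- k) x) has_integral b k) {0..1}"
    by simp
qed

section \<open>Uniqueness of Fourier coefficients\<close>

text \<open>
  Since \<open>k\<close> runs through all integers, this says that all Fourier coefficients of \<open>g\<close> vanish.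
  Multiplication by a character only shifts \<open>k\<close>, so these functions form a module over the
  trigonometric polynomials; the closure lemmas below record this.
\<close>

definition orthogonal_to_characters :: "(real \<Rightarrow> complex) \<Rightarrow> bool" where
  "orthogonal_to_characters g \<longleftrightarrow>
    continuous_on UNIV g \<and> (\<forall>k. integral {0..1} (\<lambda>x. g x * character k x) = 0)"

lemma integrable_mult_character:
  "continuous_on UNIV g \<Longrightarrow> (\<lambda>x. g x * character k x) integrable_on {0..1}"
  by (intro integrable_continuous_real continuous_intros) (auto elim: continuous_on_subset)

lemma orthogonal_to_characters_add:
  assumes "orthogonal_to_characters g" "orthogonal_to_characters h"
  shows "orthogonal_to_characters (\<lambda>x. g x + h x)"
  using assms unfolding orthogonal_to_characters_def
  by (auto intro!: continuous_intros simp: distrib_right integral_add integrable_mult_character)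

lemma orthogonal_to_characters_cmult:
  assumes "orthogonal_to_characters g"
  shows "orthogonal_to_characters (\<lambda>x. c * g x)"
  using assms unfolding orthogonal_to_characters_def
  by (auto intro!: continuous_intros simp: mult.assoc)

lemma orthogonal_to_characters_shift:
  assumes "orthogonal_to_characters g"
  shows "orthogonal_to_characters (\<lambda>x. character j x * g x)"
proof -
  have "(\<lambda>x. character j x * g x * character k x) = (\<lambda>x. g x * character (j + k) x)" for k
    by (simp add: character_add fun_eq_iff)
  with assms show ?thesis
    unfolding orthogonal_to_characters_def by (auto intro!: continuous_intros)
qed

text \<open>
  On the circle the coordinate functions are combinations of the characters \<open>1\<close> and \<open>-1\<close>, so a real
  linear form acts on the module by two shifts. Quantifying over the whole module makes the case of
  a product \<open>p q\<close> immediate: multiply by \<open>q\<close> first, then by \<open>p\<close>.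
\<close>

lemma orthogonal_to_characters_polynomial:
  assumes "real_polynomial_function p" and "orthogonal_to_characters g"
  shows "orthogonal_to_characters (\<lambda>x. of_real (p (character 1 x)) * g x)"
  using assms
proof (induction arbitrary: g rule: real_polynomial_function.induct)
  case (linear L)
  interpret bounded_linear L by fact
  \<comment> \<open>\<open>L w = Re w L(1) + Im w L(\<i>)\<close>, rewritten in terms of \<open>w\<close> and its conjugate\<close>
  define z where "z = (of_real (L 1) - \<i> * of_real (L \<i>)) / 2"
  have "of_real (L w) = z * w + cnj z * cnj w" for w
  proof -
    have "L w = L (Re w *\<^sub>R 1 + Im w *\<^sub>R \<i>)"
      by (rule arg_cong[of _ _ L]) (simp add: complex_eq_iff)
    also have "\<dots> = Re w * L 1 + Im w * L \<i>"
      by (simp only: add scale) simp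
    finally show ?thesis
      by (simp add: z_def complex_eq_iff field_simps)
  qed
  moreover have "cnj (character 1 x) = character (- 1) x" for x
    by (simp add: character_def cis_cnj)
  ultimately have "of_real (L (character 1 x)) * g x =
      z * (character 1 x * g x) + cnj z * (character (- 1) x * g x)" for x
    by (simp add: algebra_simps)
  then show ?case
    using linear.prems
    by (simp add: orthogonal_to_characters_add orthogonal_to_characters_cmult
        orthogonal_to_characters_shift)
next
  case (const c)
  then show ?case by (rule orthogonal_to_characters_cmult)
next
  case (add p q)
  then show ?case by (simp add: distrib_right orthogonal_to_characters_add)
next
  case (mult p q)
  from mult.IH(1)[OF mult.IH(2)[OF mult.prems]] show ?case
    by (simp add: mult.assoc)
qed

lemma periodic_add_of_int:
  fixes u :: "real \<Rightarrow> 'a"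
  assumes "\<And>x. u (x + 1) = u x"
  shows "u (x + of_int n) = u x"
proof (induction n rule: int_induct[where k = 0])
  case (step1 i)
  then show ?case using assms[of "x + of_int i"] by (simp add: add.assoc)
next
  case (step2 i)
  then show ?case using assms[of "x + of_int (i - 1)"] by simp
qed simp

text \<open>
  The function on the circle is \<open>u\<close> composed with an argument divided by \<open>2 \<pi>\<close>. By periodicity the
  choice of branch does not affect the value, so continuity can be read off from \<open>Arg\<close> away from the
  negative axis and from \<open>Arg2pi\<close> away from the positive axis.
\<close>

lemma continuous_on_circle_of_periodic:
  fixes u :: "real \<Rightarrow> real"
  assumes periodic: "\<And>x. u (x + 1) = u x" and cont: "continuous_on UNIV u"
  obtains h where "continuous_on (sphere 0 1) h" "\<And>x. h (character 1 x) = u x"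
proof
  define h where "h = (\<lambda>z. u (Arg z / (2 * pi)))"
  have eq: "u (s / (2 * pi)) = u (t / (2 * pi))" if "cis s = cis t" for s t
  proof -
    from that obtain n :: int where "s = t + 2 * pi * n"
      by (metis sin_cos_eq_iff cis.simps)
    then have "s / (2 * pi) = t / (2 * pi) + n" by (simp add: field_simps)
    then show ?thesis using periodic_add_of_int[of u, OF periodic] by simp
  qed
  show "h (character 1 x) = u x" for x
  proof -
    have "cis (Arg (character 1 x)) = cis (2 * pi * x)"
      by (subst cis_Arg) (auto simp: character_def sgn_div_norm)
    from eq[OF this] show ?thesis by (simp add: h_def)
  qed
  have isCont: "isCont u t" for t
    using cont by (simp add: continuous_on_eq_continuous_at)
  have h_Arg2pi: "h z = u (Arg2pi z / (2 * pi))" if "z \<noteq> 0" for z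
  proof -
    have "of_real (norm z) * cis (Arg z) = of_real (norm z) * cis (Arg2pi z)"
      using rcis_cmod_Arg[of z] Arg2pi_eq[of z] by (simp add: rcis_def flip: cis_conv_exp)
    then have "cis (Arg z) = cis (Arg2pi z)"
      using that by simp
    from eq[OF this] show ?thesis by (simp add: h_def)
  qed
  have "isCont h z" if "z \<noteq> 0" for z
  proof (cases "z \<in> \<real>\<^sub>\<le>\<^sub>0")
    case False
    then show ?thesis
      unfolding h_def
      by (intro continuous_within_compose3[OF isCont] continuous_intros continuous_at_Arg) auto
  next
    case True
    then have "z \<notin> \<real>\<^sub>\<ge>\<^sub>0"
      using that by (auto simp: complex_nonpos_Reals_iff complex_nonneg_Reals_iff complex_eq_iff)
    then have "isCont (\<lambda>z. u (Arg2pi z / (2 * pi))) z"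
      by (intro continuous_within_compose3[OF isCont] continuous_intros continuous_at_Arg2pi) auto
    moreover have "\<forall>\<^sub>F w in nhds z. h w = u (Arg2pi w / (2 * pi))"
      using t1_space_nhds[OF that] by eventually_elim (rule h_Arg2pi)
    ultimately show ?thesis by (simp add: isCont_cong)
  qed
  then show "continuous_on (sphere 0 1) h"
    by (intro continuous_at_imp_continuous_on) (metis mem_sphere_0 norm_zero zero_neq_one)
qed

text \<open>
  View \<open>u\<close> as a function on the circle and approximate it uniformly by real polynomials (Stone-Weierstrass).
  For polynomial \<open>u\<close> the integral vanishes by \<open>orthogonal_to_characters_polynomial\<close>.
\<close>

lemma integral_mult_periodic_eq_0:
  assumes orth: "orthogonal_to_characters g"
    and periodic: "\<And>x. u (x + 1) = u x" and cont: "continuous_on UNIV u"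
  shows "integral {0..1} (\<lambda>x. of_real (u x) * g x) = 0"
proof -
  from periodic cont obtain h where h: "continuous_on (sphere 0 1) h" 
    and hu: "\<And>x. h (character 1 x) = u x"
    using continuous_on_circle_of_periodic[of u] by blast
  have contg: "continuous_on {0..1} g" and contu: "continuous_on {0..1} u"
    using orth cont by (auto simp: orthogonal_to_characters_def elim: continuous_on_subset)
  have "compact (g ` {0..1})"
    by (intro compact_continuous_image contg) auto
  then obtain B where "B > 0" and B: "\<And>x. x \<in> {0..1} \<Longrightarrow> norm (g x) \<le> B"
    using bounded_pos compact_imp_bounded by (metis image_eqI)
  have "norm (integral {0..1} (\<lambda>x. of_real (u x) * g x)) \<le> e" if "e > 0" for e
  proof -
    obtain p where p: "real_polynomial_function p"
      and close: "\<And>z. z \<in> sphere 0 1 \<Longrightarrow> \<bar>h z - p z\<bar> < e / B"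
      using Stone_Weierstrass_real_polynomial_function[OF compact_sphere h, of "e / B"]
        \<open>e > 0\<close> \<open>B > 0\<close> by auto
    have orthp: "orthogonal_to_characters (\<lambda>x. of_real (p (character 1 x)) * g x)"
      by (rule orthogonal_to_characters_polynomial[OF p orth])
    then have p0: "integral {0..1} (\<lambda>x. of_real (p (character 1 x)) * g x) = 0"
      unfolding orthogonal_to_characters_def by (metis (no_types, lifting) character_0(1) integral_cong mult.right_neutral)
    have contp: "continuous_on {0..1} (\<lambda>x. of_real (p (character 1 x)) * g x)"
      using orthp by (auto simp: orthogonal_to_characters_def elim: continuous_on_subset)
    have "integral {0..1} (\<lambda>x. of_real (u x) * g x) =
        integral {0..1} (\<lambda>x. of_real (u x) * g x - of_real (p (character 1 x)) * g x)"
      by (subst integral_diff)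
         (auto simp: p0 intro!: integrable_continuous_real contp continuous_intros contu contg)
    also have "norm \<dots> \<le> e * (1 - 0)"
    proof (rule integral_bound)
      fix x :: real assume x: "x \<in> {0..1}"
      have "norm (of_real (u x) * g x - of_real (p (character 1 x)) * g x)
          = \<bar>h (character 1 x) - p (character 1 x)\<bar> * norm (g x)"
        by (simp add: hu norm_mult flip: left_diff_distrib of_real_diff)
      also have "\<dots> \<le> e / B * B"
        using close[of "character 1 x"] B[OF x] \<open>e > 0\<close> \<open>B > 0\<close> by (intro mult_mono) auto
      finally show "norm (of_real (u x) * g x - of_real (p (character 1 x)) * g x) \<le> e"
        using \<open>B > 0\<close> by simp
    qed (auto intro!: contp continuous_intros contu contg)
    finally show ?thesis by simp
  qed
  then have "norm (integral {0..1} (\<lambda>x. of_real (u x) * g x)) \<le> 0"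
    by (rule field_le_epsilon) simp
  then show ?thesis by simp
qed

lemma integral_of_real_eq:
  "f integrable_on S \<Longrightarrow> integral S (\<lambda>x. complex_of_real (f x)) = of_real (integral S f)"
  using integral_linear[OF _ bounded_linear_of_real] by (simp add: o_def)

text \<open>
  Apply \<open>integral_mult_periodic_eq_0\<close> to \<open>u = Re g\<close> and \<open>u = Im g\<close>: together they say that
  \<open>g\<close> times its conjugate has integral zero.
\<close>

theorem orthogonal_to_characters_imp_eq_0:
  assumes orth: "orthogonal_to_characters g" and periodic: "\<And>x. g (x + 1) = g x"
  shows "g x = 0"
proof -
  have cont: "continuous_on UNIV g"
    using orth by (simp add: orthogonal_to_characters_def)
  then have cont01: "continuous_on {0..1} g" by (rule continuous_on_subset) simp
  have Re0: "integral {0..1} (\<lambda>x. of_real (Re (g x)) * g x) = 0"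
    and Im0: "integral {0..1} (\<lambda>x. of_real (Im (g x)) * g x) = 0"
    by (rule integral_mult_periodic_eq_0[OF orth]; use periodic cont in \<open>auto intro!: continuous_intros\<close>)+
  have "complex_of_real (integral {0..1} (\<lambda>x. (norm (g x))\<^sup>2))
      = integral {0..1} (\<lambda>x. complex_of_real ((norm (g x))\<^sup>2))"
    by (intro integral_of_real_eq[symmetric] integrable_continuous_real continuous_intros cont01)
  also have "(\<lambda>x. complex_of_real ((norm (g x))\<^sup>2)) =
      (\<lambda>x. of_real (Re (g x)) * g x - \<i> * (of_real (Im (g x)) * g x))"
    by (auto simp: fun_eq_iff complex_eq_iff cmod_power2 simp flip: power2_eq_square)
  also have "integral {0..1} \<dots> = 0"
    by (subst integral_diff)
       (auto simp: Re0 Im0 intro!: integrable_continuous_real continuous_intros cont01)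
  finally have "\<forall>x\<in>{0..1}. (norm (g x))\<^sup>2 = 0"
    by (subst (asm) of_real_eq_0_iff, subst (asm) integral_eq_0_iff)
       (auto intro!: continuous_intros cont01)
  then have "g (frac x) = 0"
    by (auto simp: frac_lt_1 less_imp_le)
  then show ?thesis
    using periodic_add_of_int[of g "frac x" "\<lfloor>x\<rfloor>", OF periodic] by (simp add: frac_def)
qed

section \<open>Fourier inversion\<close>

lemma LINT_torus_eq_integral:
  fixes h :: "real \<Rightarrow> 'a :: euclidean_space"
  assumes "continuous_on UNIV h"
  shows "(LINT x|torus. h x) = integral {0..1} h"
proof -
  have "set_integrable lborel {0..1} h"
    using assms by (intro borel_integrable_atLeastAtMost') (auto elim: continuous_on_subset)
  then have si: "set_integrable lborel {0..<1} h"
    by (rule set_integrable_subset) auto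
  have "(LINT x|torus. h x) = (LINT x : {0..<1} | lborel. h x)"
    by (simp add: torus_def integral_restrict_space set_lebesgue_integral_def)
  also have "\<dots> = integral {0..<1} h"
    by (rule set_borel_integral_eq_integral(2)[OF si])
  also have "\<dots> = integral {0..1} h"
    by (rule integral_subset_negligible) (auto intro: negligible_subset[of "{1}"])
  finally show ?thesis .
qed

lemma fourier_coeff_eq_integral:
  assumes "continuous_on UNIV f"
  shows "fourier_coeff f k = integral {0..1} (\<lambda>x. of_real (f x) * character (- k) x)"
proof -
  have "exp (- 2 * complex_of_real pi * \<i> * of_int k * complex_of_real x) = character (- k) x" for x
    by (simp add: character_def cis_conv_exp mult_ac)
  then show ?thesis
    unfolding fourier_coeff_def
    by (simp, intro LINT_torus_eq_integral continuous_intros assms)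
qed

text \<open>
  The difference of \<open>f\<close> and its Fourier series is continuous, periodic and has vanishing
  coefficients.
\<close>

theorem fourier_inversion:
  assumes periodic: "\<And>x. f (x + 1) = f x" and cont: "continuous_on UNIV f"
    and summable: "fourier_coeff f summable_on UNIV"
  shows "((\<lambda>k. fourier_coeff f k * character k x) has_sum of_real (f x)) UNIV"
proof -
  define T where "T = (\<lambda>x. \<Sum>\<^sub>\<infinity>k. fourier_coeff f k * character k x)"
  have abs: "(\<lambda>k. norm (fourier_coeff f k)) summable_on UNIV"
    using summable by (simp flip: summable_on_iff_abs_summable_on_complex)
  have contT: "continuous_on UNIV T"
    unfolding T_def by (rule continuous_on_fourier_series[OF abs])
  have "integral {0..1} (\<lambda>x. (of_real (f x) - T x) * character k x) = 0" for k
  proof -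
    have "(\<lambda>x. of_real (f x) * character k x) integrable_on {0..1}"
      "(\<lambda>x. T x * character k x) integrable_on {0..1}"
      by (intro integrable_mult_character continuous_intros cont contT)+
    then have "integral {0..1} (\<lambda>x. (of_real (f x) - T x) * character k x) =
      integral {0..1} (\<lambda>x. of_real (f x) * character k x) - integral {0..1} (\<lambda>x. T x * character k x)"
      by (simp add: left_diff_distrib integral_diff)
    also have "integral {0..1} (\<lambda>x. T x * character k x) = fourier_coeff f (- k)"
      using has_integral_fourier_series[OF abs, of "- k"] by (simp add: T_def integral_unique)
    finally show ?thesis
      by (simp add: fourier_coeff_eq_integral[OF cont])
  qed
  then have "orthogonal_to_characters (\<lambda>x. of_real (f x) - T x)"
    unfolding orthogonal_to_characters_def by (auto intro!: continuous_intros cont contT)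
  then have "of_real (f x) - T x = 0"
    by (rule orthogonal_to_characters_imp_eq_0) (simp add: T_def periodic)
  moreover have "(\<lambda>k. fourier_coeff f k * character k x) summable_on UNIV"
    by (rule abs_summable_summable) (use abs in \<open>simp add: norm_mult\<close>)
  ultimately show ?thesis
    by (simp add: T_def has_sum_iff)
qed

lemma integrable_translate:
  fixes f :: "real \<Rightarrow> real"
  assumes "continuous_on UNIV f"
  shows "(\<lambda>y. f (y - c)) integrable_on {0..1}"
  by (rule integrable_continuous_real, rule continuous_on_compose2[OF assms])
     (auto intro!: continuous_intros)

text \<open>
  Translating \<open>f\<close> multiplies its \<open>k\<close>-th coefficient by a character value, which is \<open>1\<close> for \<open>k = 0\<close>.
\<close>

lemma integral_translate:
  assumes periodic: "\<And>x. f (x + 1) = f x" and cont: "continuous_on UNIV f"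
    and summable: "fourier_coeff f summable_on UNIV"
  shows "integral {0..1} (\<lambda>y. f (y - c)) = integral {0..1} f"
proof -
  let ?b = "\<lambda>k. fourier_coeff f k * cnj (character k c)"
  have "(\<lambda>k. norm (?b k)) summable_on UNIV"
    using summable by (simp add: norm_mult flip: summable_on_iff_abs_summable_on_complex)
  from has_integral_fourier_series[OF this, of 0]
  have "((\<lambda>y. \<Sum>\<^sub>\<infinity>k. ?b k * character k y) has_integral fourier_coeff f 0) {0..1}"
    by simp
  also have "(\<lambda>y. \<Sum>\<^sub>\<infinity>k. ?b k * character k y) = (\<lambda>y. of_real (f (y - c)))"
    using fourier_inversion[OF assms, THEN infsumI]
    by (simp add: fun_eq_iff mult_ac flip: character_diff_right)
  finally have "integral {0..1} (\<lambda>y. complex_of_real (f (y - c))) = integral {0..1} (\<lambda>y. of_real (f y))"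
    by (simp add: integral_unique fourier_coeff_eq_integral[OF cont])
  then show ?thesis
    using integrable_translate[OF cont, of c] integrable_translate[OF cont, of 0]
    by (simp add: integral_of_real_eq)
qed

section \<open>Energy\<close>

lemma has_sum_sum:
  fixes f :: "'i \<Rightarrow> 'k \<Rightarrow> 'a :: topological_comm_monoid_add"
  assumes "\<And>i. i \<in> I \<Longrightarrow> (f i has_sum s i) A"
  shows "((\<lambda>k. \<Sum>i\<in>I. f i k) has_sum (\<Sum>i\<in>I. s i)) A"
  using assms by (induction I rule: infinite_finite_induct) (auto intro: has_sum_add)

definition energy :: "(real \<Rightarrow> real) \<Rightarrow> (nat \<Rightarrow> real) \<Rightarrow> nat \<Rightarrow> real" where
  "energy f x n = (\<Sum>k=1..n. \<Sum>l=1..n. f (x k - x l))"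

lemma energy_Suc:
  assumes even: "\<And>x. f (- x) = f x"
  shows "energy f x (Suc n) = energy f x n + 2 * (\<Sum>k=1..n. f (x (Suc n) - x k)) + f 0"
proof -
  have "f (x k - x (Suc n)) = f (x (Suc n) - x k)" for k
    using even[of "x (Suc n) - x k"] by simp
  then show ?thesis
    by (simp add: energy_def sum.distrib)
qed

text \<open>
  Smallness of the energy controls the potential everywhere: both are weighted sums over
  frequencies of the exponential sums \<open>S j\<close>, quadratic for the energy and linear for the potential.
  Minimising the right-hand side over \<open>t\<close> gives the Cauchy-Schwarz bound; keeping
  \<open>t\<close> as a parameter replaces Cauchy-Schwarz for infinite sums by a termwise inequality.
\<close>

lemma abs_potential_le:
  assumes nonneg: "\<And>k. a k \<ge> 0"
    and expansion: "\<And>x. ((\<lambda>k. of_real (a k) * character k x) has_sum complex_of_real (f x)) UNIV"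
    and t: "t > 0"
  shows "\<bar>\<Sum>k=1..n. f (y - x k)\<bar> \<le> (t * f 0 + energy f x n / t) / 2"
proof -
  define S where "S = (\<lambda>j. \<Sum>k=1..n. character j (x k))"
  have "((\<lambda>j. \<Sum>k=1..n. of_real (a j) * character j (y - x k)) has_sum
      (\<Sum>k=1..n. complex_of_real (f (y - x k)))) UNIV"
    by (intro has_sum_sum expansion)
  then have potential: "((\<lambda>j. of_real (a j) * (character j y * cnj (S j))) has_sum
      of_real (\<Sum>k=1..n. f (y - x k))) UNIV"
    by (simp add: character_diff_right S_def sum_distrib_left)
  have "((\<lambda>j. \<Sum>k=1..n. \<Sum>l=1..n. of_real (a j) * character j (x k - x l)) has_sum
      (\<Sum>k=1..n. \<Sum>l=1..n. complex_of_real (f (x k - x l)))) UNIV"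
    by (intro has_sum_sum expansion)
  moreover have "(\<Sum>k=1..n. \<Sum>l=1..n. of_real (a j) * character j (x k - x l))
      = complex_of_real (a j * (norm (S j))\<^sup>2)" for j
  proof -
    have "complex_of_real (a j * (norm (S j))\<^sup>2) = of_real (a j) * (S j * cnj (S j))"
      by (simp add: complex_norm_square flip: of_real_power)
    also have "S j * cnj (S j) = (\<Sum>k=1..n. \<Sum>l=1..n. character j (x k - x l))"
      by (simp add: S_def sum_product character_diff_right)
    finally show ?thesis by (simp add: sum_distrib_left)
  qed
  ultimately have "((\<lambda>j. complex_of_real (a j * (norm (S j))\<^sup>2)) has_sum
      complex_of_real (energy f x n)) UNIV"
    by (simp add: energy_def)
  then have energy: "((\<lambda>j. a j * (norm (S j))\<^sup>2) has_sum energy f x n) UNIV"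
    by (simp only: has_sum_of_real_iff)
  have "(a has_sum f 0) UNIV"
    using expansion[of 0] by (simp add: has_sum_of_real_iff)
  then have bound: "((\<lambda>j. (t * a j + a j * (norm (S j))\<^sup>2 / t) / 2) has_sum
      (t * f 0 + energy f x n / t) / 2) UNIV"
    unfolding divide_inverse
    by (intro has_sum_cmult_left has_sum_add has_sum_cmult_right energy)
  have le: "norm (of_real (a j) * (character j y * cnj (S j)))
      \<le> (t * a j + a j * (norm (S j))\<^sup>2 / t) / 2" for j
  proof -
    have "0 \<le> (t - norm (S j))\<^sup>2 / t" using t by simp
    also have "\<dots> = t + (norm (S j))\<^sup>2 / t - 2 * norm (S j)"
      using t by (simp add: power2_eq_square field_simps)
    finally have "norm (S j) \<le> (t + (norm (S j))\<^sup>2 / t) / 2" by simp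
    from mult_left_mono[OF this nonneg[of j]] show ?thesis
      using nonneg[of j] by (simp add: norm_mult algebra_simps)
  qed
  have "norm (complex_of_real (\<Sum>k=1..n. f (y - x k))) \<le> (t * f 0 + energy f x n / t) / 2"
    by (rule norm_infsum_le[OF potential bound]) (rule le)
  then show ?thesis by (simp only: norm_of_real)
qed

text \<open>
  This is \<open>abs_potential_le\<close> for a single point, whose energy is \<open>f 0\<close>.
\<close>

lemma abs_le_at_0:
  assumes nonneg: "\<And>k. a k \<ge> 0"
    and expansion: "\<And>x. ((\<lambda>k. of_real (a k) * character k x) has_sum complex_of_real (f x)) UNIV"
  shows "\<bar>f y\<bar> \<le> f 0"
  using abs_potential_le[OF assms, where t = 1 and n = 1 and x = "\<lambda>_. 0" and y = y]
  by (simp add: energy_def)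

text \<open>
  Up to \<open>n = m\<close> the trivial bound \<open>n\<^sup>2 f(0)\<close> suffices; beyond that, the energy gains at most
  \<open>f(0)\<close> with each point.
\<close>

lemma energy_le:
  fixes f :: "real \<Rightarrow> real" and m n :: nat
  assumes bound: "\<And>y. \<bar>f y\<bar> \<le> f 0"
    and even: "\<And>x. f (- x) = f x"
    and step: "\<And>n. n \<ge> m \<Longrightarrow> (\<Sum>k=1..n. f (x (Suc n) - x k)) \<le> 0"
    and m: "m \<ge> 1"
  shows "energy f x n \<le> m * n * f 0"
proof -
  have trivial: "energy f x n \<le> n * n * f 0" for n
  proof -
    have "energy f x n \<le> (\<Sum>k=1..n. \<Sum>l=1..n. f 0)"
      unfolding energy_def by (intro sum_mono) (rule abs_le_D1[OF bound])
    then show ?thesis by simp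
  qed
  show ?thesis
  proof (cases "n \<le> m")
    case True
    have "n * n * f 0 \<le> m * n * f 0"
      using True bound[of 0] by (auto intro!: mult_right_mono)
    with trivial[of n] show ?thesis by simp
  next
    case False
    then have "n \<ge> m" by simp
    then show ?thesis
    proof (induction n rule: dec_induct)
      case base
      show ?case using trivial[of m] by simp
    next
      case (step n)
      have "energy f x (Suc n) \<le> m * n * f 0 + 1 * f 0"
        using step.IH assms(3)[OF step.hyps(1)] energy_Suc[of f x n, OF even] by simp
      also have "\<dots> \<le> m * n * f 0 + m * f 0"
        using m bound[of 0] by (intro add_left_mono mult_right_mono) auto
      finally show ?case by (simp add: algebra_simps)
    qed
  qed
qed

text \<open>
  A lower bound of a function of mean zero cannot be positive. Integrating over the open interval
  avoids the endpoint \<open>1\<close>, which is outside the fundamental domain.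
\<close>

lemma min_potential_nonpos:
  fixes f :: "real \<Rightarrow> real" and p :: real and n :: nat
  assumes cont: "continuous_on UNIV f"
    and translates: "\<And>c. integral {0..1} (\<lambda>y. f (y - c)) = 0"
    and min: "\<And>y. y \<in> {0..<1} \<Longrightarrow> p \<le> (\<Sum>k=1..n. f (y - x k))"
  shows "p \<le> 0"
proof -
  note int = integrable_translate[OF cont]
  have "integral {0<..<1} (\<lambda>y::real. p) \<le> integral {0<..<1} (\<lambda>y. \<Sum>k=1..n. f (y - x k))"
  proof (rule integral_le)
    show "(\<lambda>y. \<Sum>k=1..n. f (y - x k)) integrable_on {0<..<1::real}"
      unfolding integrable_on_open_interval_real by (intro integrable_sum int) simp
  qed (use min in \<open>auto simp: integrable_on_open_interval_real\<close>)
  then show ?thesis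
    by (simp add: integral_sum int translates flip: integral_open_interval_real)
qed

theorem corollary1:
  fixes f :: "real \<Rightarrow> real" and A :: "real set" and m :: nat
  assumes periodic: "\<And>x. f (x + 1) = f x"
    and cont: "continuous_on UNIV f"
    and even: "\<And>x. f (- x) = f x"
    and mean_zero: "(LINT x|torus. f x) = 0"
    and pos: "\<And>k. k \<noteq> 0 \<Longrightarrow> fourier_coeff f k > 0"
    and summable: "fourier_coeff f summable_on UNIV"
    and m: "m \<ge> 1"
  shows "\<exists>C::real. C > 0 \<and>
    (\<forall>x :: nat \<Rightarrow> real.
      (\<forall>n\<ge>1. x n \<in> {0..<1}) \<longrightarrow>
      x ` {1..m} = A \<longrightarrow>
      (\<forall>n>m. is_arg_min (\<lambda>y. \<Sum>k=1..n-1. f (y - x k)) (\<lambda>y. y \<in> {0..<1}) (x n)) \<longrightarrow>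
      (\<forall>n\<ge>1. Linf_norm (\<lambda>y. \<Sum>k=1..n. f (y - x k)) \<le> ereal (C * sqrt (real n))))"
proof -
  define a where "a = (\<lambda>k. Re (fourier_coeff f k))"
  have int0: "integral {0..1} f = 0"
    using mean_zero by (simp add: LINT_torus_eq_integral[OF cont])
  have translates: "integral {0..1} (\<lambda>y. f (y - c)) = 0" for c
    by (simp add: integral_translate[OF periodic cont summable] int0)
  have "fourier_coeff f 0 = 0"
    using integral_of_real_eq[OF integrable_translate[OF cont, of 0]]
    by (simp add: fourier_coeff_eq_integral[OF cont] int0)
  then have "fourier_coeff f k \<ge> 0" for k
    using pos[of k] by (cases "k = 0") auto
  then have nonneg: "a k \<ge> 0" and coeff: "fourier_coeff f k = of_real (a k)" for k
    by (auto simp: a_def less_eq_complex_def complex_eq_iff)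
  have expansion: "((\<lambda>k. of_real (a k) * character k x) has_sum complex_of_real (f x)) UNIV" for x
    using fourier_inversion[OF periodic cont summable] by (simp add: coeff)
  have bound: "\<bar>f y\<bar> \<le> f 0" for y
    by (rule abs_le_at_0[OF nonneg expansion])
  \<comment> \<open>\<open>(1 + m) f(0) / 2\<close> comes from \<open>abs_potential_le\<close> with \<open>t = sqrt n\<close>; adding \<open>1\<close> makes it
      visibly positive\<close>
  define C where "C = (1 + m) * f 0 / 2 + 1"
  have "C > 0" using bound[of 0] by (simp add: C_def add_nonneg_pos)
  moreover have "Linf_norm (\<lambda>y. \<Sum>k=1..n. f (y - x k)) \<le> ereal (C * sqrt n)"
    if argmin: "\<forall>n>m. is_arg_min (\<lambda>y. \<Sum>k=1..n-1. f (y - x k)) (\<lambda>y. y \<in> {0..<1}) (x n)"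
      and n: "n \<ge> 1" for x n
  proof -
    have "(\<Sum>k=1..n. f (x (Suc n) - x k)) \<le> 0" if "n \<ge> m" for n
    proof (rule min_potential_nonpos[OF cont translates])
      have "is_arg_min (\<lambda>y. \<Sum>k=1..n. f (y - x k)) (\<lambda>y. y \<in> {0..<1}) (x (Suc n))"
        using argmin[rule_format, of "Suc n"] that by simp
      then show "(\<Sum>k=1..n. f (x (Suc n) - x k)) \<le> (\<Sum>k=1..n. f (y - x k))"
        if "y \<in> {0..<1}" for y
        using that unfolding is_arg_min_linorder by blast
    qed
    then have E: "energy f x n \<le> m * n * f 0"
      by (rule energy_le[OF bound even _ m])
    have "\<bar>\<Sum>k=1..n. f (y - x k)\<bar> \<le> C * sqrt n" for y
    proof -
      have "\<bar>\<Sum>k=1..n. f (y - x k)\<bar> \<le> (sqrt n * f 0 + energy f x n / sqrt n) / 2"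
        using n by (intro abs_potential_le[OF nonneg expansion]) auto
      also have "\<dots> \<le> (sqrt n * f 0 + m * n * f 0 / sqrt n) / 2"
        using E by (intro divide_right_mono add_left_mono) auto
      also have "m * n * f 0 / sqrt n = m * f 0 * (n / sqrt n)" by simp
      also have "n / sqrt n = sqrt n" by (simp add: real_div_sqrt)
      also have "(sqrt n * f 0 + m * f 0 * sqrt n) / 2 \<le> C * sqrt n"
        by (simp add: C_def algebra_simps add_divide_distrib)
      finally show ?thesis .
    qed
    moreover have "(\<lambda>y. ereal \<bar>\<Sum>k=1..n. f (y - x k)\<bar>) \<in> borel_measurable torus"
    proof -
      have "(\<lambda>y. \<Sum>k=1..n. f (y - x k)) \<in> borel_measurable borel"
        by (intro borel_measurable_continuous_onI continuous_on_sum
            continuous_on_compose2[OF cont]) (auto intro!: continuous_intros)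
      from borel_measurable_ereal[OF borel_measurable_abs[OF this]] show ?thesis
        unfolding torus_def by (intro measurable_restrict_space1) simp
    qed
    ultimately show ?thesis
      unfolding Linf_norm_def by (intro esssup_I) auto
  qed
  ultimately show ?thesis by blast
qed

end
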